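(* Let $H_+$ be a finite-dimensional Hopf algebra over $\mathbb{C}$ with invertible antipode, let $H=D(H_+)$ be its quantum double, and suppose $H$ is equipped with an involution $\tau$ such that $\tau(H_+)\subset H_+$ and $\tau(H_-)\subset H_-$. Let $\{e_\mu\}\subset H_+$ and $\{e^\mu\}\subset H_+^*$ be dual bases. Then the universal S-matrix $S\in H\otimes H^{\circledast}$ (the canonical element of $H\otimes H^\circledast$) factorizes in the algebra $H\otimes H^\circledast$ as $$S=\Bigl(\sum_\mu e_\mu\otimes e^\mu\Bigr)\Bigl(\sum_\nu e^\nu\otimes e_\nu\Bigr),$$ where in the first factor $e_\mu\in H_+\subset H$ and $e^\mu\in H_+^*\subset H^\circledast$, and in the second factor $e^\nu\in H_-\subset H$ and $e_\nu\in H_{+op}\subset H^\circledast$.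
   Context: All algebras are over $\mathbb{C}$; summation over tensor components is suppressed. The superscript $op$ denotes opposite comultiplication and the subscript $op$ opposite multiplication. Quantum double: put $H_-=H_+^{*op}$ (the dual Hopf algebra with opposite comultiplication). $H=D(H_+)$ equals $H_+\otimes H_-$ as a vector space and as an $H_+$-$H_-$-bimodule (write $x\xi$ for $x\otimes\xi$), both factors are sub-bialgebras, and the cross relations are $\langle\xi^{(1)},x^{(1)}\rangle\,\xi^{(2)}x^{(2)}=x^{(1)}\xi^{(1)}\langle\xi^{(2)},x^{(2)}\rangle$ for $\xi\in H_-$, $x\in H_+$, with Sweedler components taken in $H_\pm$ and $\langle\cdot,\cdot\rangle$ the canonical pairing of $H_+^*$ with $H_+$. The universal R-matrix is $\mathcal{R}=\bigl(\sum_\mu e^\mu\otimes e_\mu\bigr)^{-1}\in H_-\otimes H_+\subset H\otimes H$. Involution: $\tau\colon H\to H$ is linear with $\tau^2=\mathrm{id}$, a coalgebra map and an anti-automorphism of algebras. The dual algebra $H^*$ (product dual to the coproduct of $H$) is, as an algebra, $H_+^*\otimes H_-^*=H_+^*\otimes H_{+op}$, with pairing $\langle\xi\otimes x,z\zeta\rangle=\langle\xi,z\rangle\langle\zeta,x\rangle$ for $\xi\in H_+^*$, $x\in H_{+op}$, $z\in H_+$, $\zeta\in H_-$. $H^*$ is an $H$-bimodule by $\langle h\triangleright a,x\rangle=\langle a,xh\rangle$, $\langle a\triangleleft h,x\rangle=\langle a,hx\rangle$. The RE dual $H^\circledast$ is the vector space $H^*$ with the associative product $\tilde m(a\otimes b)=m\bigl(\tau(\bar{\mathcal{R}}_1)\triangleright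 a\otimes b\triangleleft\bar{\mathcal{R}}_2\bigr)$, where $m$ is the product of $H^*$ and $\bar{\mathcal R}=\mathcal{R}^{-1}$. The subspaces $H_+^*=H_+^*\otimes 1$ and $H_{+op}=1\otimes H_{+op}$ are subalgebras of $H^\circledast$. The universal S-matrix $S\in H\otimes H^\circledast$ is the canonical element $\sum_\alpha f_\alpha\otimes f^\alpha$ for any basis $\{f_\alpha\}$ of $H$ and dual basis $\{f^\alpha\}$ of $H^*=H^\circledast$ (equality of vector spaces). *)

theory Defs
  imports Complex_Main "HOL-Library.Poly_Mapping"
begin

section \<open>Complex vector spaces\<close>

class complex_vector = ab_group_add +
  fixes scaleC :: "complex \<Rightarrow> 'a \<Rightarrow> 'a"  (infixr "*\<^sub>C" 75)
  assumes scaleC_add_right: "c *\<^sub>C (x + y) = c *\<^sub>C x + c *\<^sub>C y"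
    and scaleC_add_left: "(c + d) *\<^sub>C x = c *\<^sub>C x + d *\<^sub>C x"
    and scaleC_scaleC: "c *\<^sub>C d *\<^sub>C x = (c * d) *\<^sub>C x"
    and scaleC_one: "1 *\<^sub>C x = x"

global_interpretation cvs: vector_space "scaleC :: complex \<Rightarrow> 'a \<Rightarrow> 'a::complex_vector"
  by unfold_locales (simp_all add: scaleC_add_right scaleC_add_left scaleC_scaleC scaleC_one)

abbreviation clinear :: "('a::complex_vector \<Rightarrow> 'b::complex_vector) \<Rightarrow> bool" where
  "clinear \<equiv> Vector_Spaces.linear (*\<^sub>C) (*\<^sub>C)"

lemma clinear_iff:
  "clinear f \<longleftrightarrow> (\<forall>x y. f (x + y) = f x + f y) \<and> (\<forall>c x. f (c *\<^sub>C x) = c *\<^sub>C f x)"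
  by (simp add: Vector_Spaces.linear_iff cvs.vector_space_axioms)

lemma clinear_add: "clinear f \<Longrightarrow> f (x + y) = f x + f y"
  and clinear_scale: "clinear f \<Longrightarrow> f (c *\<^sub>C x) = c *\<^sub>C f x"
  by (simp_all add: clinear_iff)

lemma clinear_0: "clinear f \<Longrightarrow> f 0 = 0"
  using clinear_add[of f 0 0] by simp

lemma clinear_diff: "clinear f \<Longrightarrow> f (x - y) = f x - f y"
  using clinear_add[of f "x - y" y] by (simp add: algebra_simps)

lemma clinear_sum: "clinear f \<Longrightarrow> f (\<Sum>i\<in>I. g i) = (\<Sum>i\<in>I. f (g i))"
  by (induction I rule: infinite_finite_induct) (simp_all add: clinear_0 clinear_add)

definition cbilinear :: "('a::complex_vector \<Rightarrow> 'b::complex_vector \<Rightarrow> 'c::complex_vector) \<Rightarrow> bool" where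
  "cbilinear f \<longleftrightarrow> (\<forall>x. clinear (f x)) \<and> (\<forall>y. clinear (\<lambda>x. f x y))"

definition finite_dim :: "'a::complex_vector itself \<Rightarrow> bool" where
  "finite_dim _ \<longleftrightarrow> (\<exists>B :: 'a set. finite B \<and> cvs.span B = UNIV)"

instantiation complex :: complex_vector
begin
definition scaleC_complex :: "complex \<Rightarrow> complex \<Rightarrow> complex" where
  "scaleC_complex c x = c * x"
instance
  by standard (simp_all add: scaleC_complex_def algebra_simps)
end


section \<open>Dual spaces\<close>

typedef (overloaded) 'a dual = "{f :: 'a::complex_vector \<Rightarrow> complex. clinear f}"
  morphisms pairing Dual
proof
  show "(\<lambda>_. 0) \<in> {f :: 'a \<Rightarrow> complex. clinear f}"
    by (simp add: clinear_iff)
qed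

setup_lifting type_definition_dual

notation pairing ("\<langle>_,/ _\<rangle>")

lemma clinear_pairing: "clinear (pairing \<xi>)"
  using pairing by blast

instantiation dual :: (complex_vector) complex_vector
begin
lift_definition zero_dual :: "'a dual" is "\<lambda>_. 0"
  by (simp add: clinear_iff)
lift_definition plus_dual :: "'a dual \<Rightarrow> 'a dual \<Rightarrow> 'a dual" is "\<lambda>f g x. f x + g x"
  by (simp add: clinear_iff scaleC_complex_def algebra_simps)
lift_definition uminus_dual :: "'a dual \<Rightarrow> 'a dual" is "\<lambda>f x. - f x"
  by (simp add: clinear_iff scaleC_complex_def algebra_simps)
lift_definition minus_dual :: "'a dual \<Rightarrow> 'a dual \<Rightarrow> 'a dual" is "\<lambda>f g x. f x - g x"
  by (simp add: clinear_iff scaleC_complex_def algebra_simps)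
lift_definition scaleC_dual :: "complex \<Rightarrow> 'a dual \<Rightarrow> 'a dual" is "\<lambda>c f x. c * f x"
  by (simp add: clinear_iff scaleC_complex_def algebra_simps)
instance
  by standard (transfer; simp add: fun_eq_iff algebra_simps)+
end

lemma pairing_simps [simp]:
  "\<langle>0, x\<rangle> = 0"
  "\<langle>\<xi> + \<eta>, x\<rangle> = \<langle>\<xi>, x\<rangle> + \<langle>\<eta>, x\<rangle>"
  "\<langle>\<xi> - \<eta>, x\<rangle> = \<langle>\<xi>, x\<rangle> - \<langle>\<eta>, x\<rangle>"
  "\<langle>c *\<^sub>C \<xi>, x\<rangle> = c * \<langle>\<xi>, x\<rangle>"
  by (transfer; simp)+

lemma pairing_sum: "\<langle>\<Sum>i\<in>I. \<xi> i, x\<rangle> = (\<Sum>i\<in>I. \<langle>\<xi> i, x\<rangle>)"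
  by (induction I rule: infinite_finite_induct) simp_all

lemma dual_eqI: "(\<And>x. \<langle>\<xi>, x\<rangle> = \<langle>\<eta>, x\<rangle>) \<Longrightarrow> \<xi> = \<eta>"
  by transfer (rule ext)

lemma pairing_Dual: "clinear f \<Longrightarrow> \<langle>Dual f, x\<rangle> = f x"
  by (simp add: Dual_inverse)

definition is_basis :: "'i set \<Rightarrow> ('i \<Rightarrow> 'a::complex_vector) \<Rightarrow> bool" where
  "is_basis I e \<longleftrightarrow> inj_on e I \<and> cvs.independent (e ` I) \<and> cvs.span (e ` I) = UNIV"

definition dual_bases :: "'i set \<Rightarrow> ('i \<Rightarrow> 'a::complex_vector) \<Rightarrow> ('i \<Rightarrow> 'a dual) \<Rightarrow> bool" where
  "dual_bases I e e' \<longleftrightarrow> finite I \<and> is_basis I e \<and>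
     (\<forall>i\<in>I. \<forall>j\<in>I. \<langle>e' i, e j\<rangle> = (if i = j then 1 else 0))"


section \<open>Tensor products\<close>

instantiation poly_mapping :: (type, complex_vector) complex_vector
begin
lift_definition scaleC_poly_mapping :: "complex \<Rightarrow> ('a \<Rightarrow>\<^sub>0 'b) \<Rightarrow> 'a \<Rightarrow>\<^sub>0 'b" is "\<lambda>c f k. c *\<^sub>C f k"
  by (metis (mono_tags, lifting) cvs.scale_zero_right finite_subset mem_Collect_eq subsetI)
instance
  by standard (transfer; simp add: fun_eq_iff scaleC_add_right scaleC_add_left scaleC_scaleC scaleC_one)+
end

lemma lookup_scaleC: "Poly_Mapping.lookup (c *\<^sub>C p) k = c *\<^sub>C Poly_Mapping.lookup p k"
  by transfer simp

text \<open>The space of formal combinations of pairs is divided by the bilinearity relations.\<close>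

definition tensor_rels :: "('a::complex_vector \<times> 'b::complex_vector \<Rightarrow>\<^sub>0 complex) set" where
  "tensor_rels =
     {Poly_Mapping.single (x + y, z) 1 - Poly_Mapping.single (x, z) 1 - Poly_Mapping.single (y, z) 1 | x y z. True}
   \<union> {Poly_Mapping.single (x, y + z) 1 - Poly_Mapping.single (x, y) 1 - Poly_Mapping.single (x, z) 1 | x y z. True}
   \<union> {Poly_Mapping.single (c *\<^sub>C x, y) 1 - c *\<^sub>C Poly_Mapping.single (x, y) 1 | c x y. True}
   \<union> {Poly_Mapping.single (x, c *\<^sub>C y) 1 - c *\<^sub>C Poly_Mapping.single (x, y) 1 | c x y. True}"

definition tensor_eq ::
  "('a::complex_vector \<times> 'b::complex_vector \<Rightarrow>\<^sub>0 complex) \<Rightarrow> ('a \<times> 'b \<Rightarrow>\<^sub>0 complex) \<Rightarrow> bool" where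
  "tensor_eq p q \<longleftrightarrow> p - q \<in> cvs.span tensor_rels"

quotient_type (overloaded) ('a, 'b) tensor (infixr "\<otimes>" 75) =
  "'a::complex_vector \<times> 'b::complex_vector \<Rightarrow>\<^sub>0 complex" / tensor_eq
proof (rule equivpI)
  show "reflp tensor_eq"
    by (simp add: reflp_def tensor_eq_def cvs.span_zero)
  show "symp tensor_eq"
    unfolding symp_def tensor_eq_def using cvs.span_neg by fastforce
  show "transp tensor_eq"
    unfolding transp_def tensor_eq_def using cvs.span_add by fastforce
qed

lemma tensor_eqI: "p = q \<Longrightarrow> tensor_eq p q"
  by (simp add: tensor_eq_def cvs.span_zero)

instantiation tensor :: (complex_vector, complex_vector) complex_vector
begin
lift_definition zero_tensor :: "'a \<otimes> 'b" is 0 .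
lift_definition plus_tensor :: "'a \<otimes> 'b \<Rightarrow> 'a \<otimes> 'b \<Rightarrow> 'a \<otimes> 'b" is "(+)"
  unfolding tensor_eq_def by (subst add_diff_add) (rule cvs.span_add)
lift_definition uminus_tensor :: "'a \<otimes> 'b \<Rightarrow> 'a \<otimes> 'b" is uminus
  unfolding tensor_eq_def by (subst minus_diff_minus) (rule cvs.span_neg)
lift_definition minus_tensor :: "'a \<otimes> 'b \<Rightarrow> 'a \<otimes> 'b \<Rightarrow> 'a \<otimes> 'b" is "(-)"
proof -
  fix p q p' q' :: "'a \<times> 'b \<Rightarrow>\<^sub>0 complex"
  assume "tensor_eq p q" "tensor_eq p' q'"
  then have "(p - q) - (p' - q') \<in> cvs.span tensor_rels"
    unfolding tensor_eq_def by (rule cvs.span_diff)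
  also have "(p - q) - (p' - q') = (p - p') - (q - q')"
    by (simp only: diff_diff_eq2 diff_add_eq diff_diff_eq) (simp only: ac_simps)
  finally show "tensor_eq (p - p') (q - q')"
    unfolding tensor_eq_def .
qed
lift_definition scaleC_tensor :: "complex \<Rightarrow> 'a \<otimes> 'b \<Rightarrow> 'a \<otimes> 'b" is "(*\<^sub>C)"
  unfolding tensor_eq_def by (subst cvs.scale_right_diff_distrib[symmetric]) (rule cvs.span_scale)
instance
proof
  fix a b c :: "'a \<otimes> 'b" and k l :: complex
  show "a + b + c = a + (b + c)"
    by transfer (rule tensor_eqI, rule add.assoc)
  show "a + b = b + a"
    by transfer (rule tensor_eqI, rule add.commute)
  show "0 + a = a"
    by transfer (rule tensor_eqI, rule add_0)
  show "- a + a = 0"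
    by transfer (rule tensor_eqI, rule left_minus)
  show "a - b = a + - b"
    by transfer (rule tensor_eqI, rule diff_conv_add_uminus)
  show "k *\<^sub>C (a + b) = k *\<^sub>C a + k *\<^sub>C b"
    by transfer (rule tensor_eqI, rule scaleC_add_right)
  show "(k + l) *\<^sub>C a = k *\<^sub>C a + l *\<^sub>C a"
    by transfer (rule tensor_eqI, rule scaleC_add_left)
  show "k *\<^sub>C l *\<^sub>C a = (k * l) *\<^sub>C a"
    by transfer (rule tensor_eqI, rule scaleC_scaleC)
  show "1 *\<^sub>C a = a"
    by transfer (rule tensor_eqI, rule scaleC_one)
qed
end

lift_definition tens :: "'a::complex_vector \<Rightarrow> 'b::complex_vector \<Rightarrow> 'a \<otimes> 'b"  (infixr "\<otimes>" 75)
  is "\<lambda>x y. Poly_Mapping.single (x, y) 1" .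

lemma cbilinear_tens: "cbilinear (\<otimes>)"
proof -
  have rels:
    "Poly_Mapping.single (x, y + z) 1 - Poly_Mapping.single (x, y) 1 - Poly_Mapping.single (x, z) 1 \<in> tensor_rels"
    "Poly_Mapping.single (x + x', y) 1 - Poly_Mapping.single (x, y) 1 - Poly_Mapping.single (x', y) 1 \<in> tensor_rels"
    "Poly_Mapping.single (x, c *\<^sub>C y) 1 - c *\<^sub>C Poly_Mapping.single (x, y) 1 \<in> tensor_rels"
    "Poly_Mapping.single (c *\<^sub>C x, y) 1 - c *\<^sub>C Poly_Mapping.single (x, y) 1 \<in> tensor_rels"
    for c and x x' :: 'a and y z :: 'b
    unfolding tensor_rels_def by blast+
  have "x \<otimes> (y + z) = x \<otimes> y + x \<otimes> z" for x :: 'a and y z :: 'b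
    by transfer (simp only: tensor_eq_def diff_diff_eq[symmetric] cvs.span_base rels)
  moreover have "(x + y) \<otimes> z = x \<otimes> z + y \<otimes> z" for x y :: 'a and z :: 'b
    by transfer (simp only: tensor_eq_def diff_diff_eq[symmetric] cvs.span_base rels)
  moreover have "x \<otimes> (c *\<^sub>C y) = c *\<^sub>C (x \<otimes> y)" for c and x :: 'a and y :: 'b
    by transfer (simp only: tensor_eq_def cvs.span_base rels)
  moreover have "(c *\<^sub>C x) \<otimes> y = c *\<^sub>C (x \<otimes> y)" for c and x :: 'a and y :: 'b
    by transfer (simp only: tensor_eq_def cvs.span_base rels)
  ultimately show ?thesis
    by (simp add: cbilinear_def clinear_iff)
qed

definition free_extend ::
  "('a::complex_vector \<Rightarrow> 'b::complex_vector \<Rightarrow> 'c::complex_vector) \<Rightarrow> ('a \<times> 'b \<Rightarrow>\<^sub>0 complex) \<Rightarrow> 'c" where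
  "free_extend f p = (\<Sum>k\<in>Poly_Mapping.keys p. Poly_Mapping.lookup p k *\<^sub>C f (fst k) (snd k))"

lemma free_extend_superset:
  assumes "finite A" "Poly_Mapping.keys p \<subseteq> A"
  shows "free_extend f p = (\<Sum>k\<in>A. Poly_Mapping.lookup p k *\<^sub>C f (fst k) (snd k))"
  unfolding free_extend_def
  by (rule sum.mono_neutral_left) (use assms in \<open>auto simp: in_keys_iff\<close>)

lemma clinear_free_extend: "clinear (free_extend f)"
proof -
  have "free_extend f (p + q) = free_extend f p + free_extend f q" for p q
  proof -
    let ?A = "Poly_Mapping.keys p \<union> Poly_Mapping.keys q"
    have "Poly_Mapping.keys (p + q) \<subseteq> ?A" by (rule Poly_Mapping.keys_add)
    then show ?thesis
      by (simp add: free_extend_superset[of ?A] lookup_add scaleC_add_left sum.distrib)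
  qed
  moreover have "free_extend f (c *\<^sub>C p) = c *\<^sub>C free_extend f p" for c p
  proof -
    have "Poly_Mapping.keys (c *\<^sub>C p) \<subseteq> Poly_Mapping.keys p"
      by (auto simp: in_keys_iff lookup_scaleC)
    then show ?thesis
      by (simp add: free_extend_superset[of "Poly_Mapping.keys p"] lookup_scaleC scaleC_complex_def
          cvs.scale_sum_right)
  qed
  ultimately show ?thesis by (simp add: clinear_iff)
qed

lemma free_extend_single: "free_extend f (Poly_Mapping.single (x, y) c) = c *\<^sub>C f x y"
  by (simp add: free_extend_superset[of "{(x, y)}"])

lemma free_extend_rels:
  assumes "cbilinear f" "p \<in> cvs.span tensor_rels"
  shows "free_extend f p = 0"
proof -
  note [simp] = clinear_diff[OF clinear_free_extend] clinear_scale[OF clinear_free_extend]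
    free_extend_single scaleC_one
  have "free_extend f r = 0" if "r \<in> tensor_rels" for r
    using that assms(1)
    by (auto simp: tensor_rels_def cbilinear_def clinear_iff)
  with assms(2) show ?thesis
    by (induction rule: cvs.span_induct_alt)
      (simp_all add: clinear_0[OF clinear_free_extend] clinear_add[OF clinear_free_extend])
qed

text \<open>The linear map induced by a bilinear map; it is \<open>0\<close> if the argument is not bilinear.\<close>

lift_definition tensor_lift ::
  "('a::complex_vector \<Rightarrow> 'b::complex_vector \<Rightarrow> 'c::complex_vector) \<Rightarrow> 'a \<otimes> 'b \<Rightarrow> 'c"
  is "\<lambda>f p. if cbilinear f then free_extend f p else 0"
  using free_extend_rels by (fastforce simp: tensor_eq_def clinear_diff[OF clinear_free_extend])

lemma clinear_tensor_lift: "clinear (tensor_lift f)"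
proof -
  have "tensor_lift f (s + t) = tensor_lift f s + tensor_lift f t" for s t
    by transfer (simp add: clinear_add[OF clinear_free_extend])
  moreover have "tensor_lift f (c *\<^sub>C t) = c *\<^sub>C tensor_lift f t" for c t
    by transfer (simp add: clinear_scale[OF clinear_free_extend])
  ultimately show ?thesis by (simp add: clinear_iff)
qed

lemma tensor_lift_tens: "cbilinear f \<Longrightarrow> tensor_lift f (x \<otimes> y) = f x y"
  by transfer (simp add: free_extend_single scaleC_one)

lemma tensor_span: "cvs.span {x \<otimes> y | x y. True} = (UNIV :: ('a::complex_vector \<otimes> 'b::complex_vector) set)"
proof -
  have "t \<in> cvs.span {x \<otimes> y | x y. True}" for t :: "'a \<otimes> 'b"
  proof -
    obtain p where t: "t = abs_tensor p"
      by (metis Quotient3_abs_rep Quotient3_tensor)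
    have lin: "clinear (abs_tensor :: ('a \<times> 'b \<Rightarrow>\<^sub>0 complex) \<Rightarrow> 'a \<otimes> 'b)"
      by (simp add: clinear_iff plus_tensor.abs_eq scaleC_tensor.abs_eq)
    have "p = (\<Sum>k\<in>Poly_Mapping.keys p. Poly_Mapping.lookup p k *\<^sub>C Poly_Mapping.single k 1)"
      by (rule poly_mapping_eqI)
        (simp add: lookup_sum lookup_scaleC lookup_single when_def scaleC_complex_def in_keys_iff
          if_distrib cong: if_cong)
    then have "t = abs_tensor (\<Sum>k\<in>Poly_Mapping.keys p. Poly_Mapping.lookup p k *\<^sub>C Poly_Mapping.single k 1)"
      unfolding t by (rule arg_cong)
    also have "\<dots> = (\<Sum>k\<in>Poly_Mapping.keys p. Poly_Mapping.lookup p k *\<^sub>C abs_tensor (Poly_Mapping.single k 1))"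
      by (simp only: clinear_sum[OF lin] clinear_scale[OF lin])
    also have "\<dots> = (\<Sum>k\<in>Poly_Mapping.keys p. Poly_Mapping.lookup p k *\<^sub>C (fst k \<otimes> snd k))"
      by (simp add: tens.abs_eq)
    also have "\<dots> \<in> cvs.span {x \<otimes> y | x y. True}"
      by (intro cvs.span_sum cvs.span_scale cvs.span_base) blast
    finally show ?thesis .
  qed
  then show ?thesis by blast
qed

lemma clinear_eq_on_tens:
  fixes f g :: "'a::complex_vector \<otimes> 'b::complex_vector \<Rightarrow> 'c::complex_vector"
  assumes "clinear f" "clinear g" "\<And>x y. f (x \<otimes> y) = g (x \<otimes> y)"
  shows "f t = g t"
proof -
  have "t \<in> cvs.span {x \<otimes> y | x y. True}"
    unfolding tensor_span by (rule UNIV_I)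
  then show ?thesis
    by (induction rule: cvs.span_induct_alt)
      (use assms in \<open>auto simp: clinear_0 clinear_add clinear_scale\<close>)
qed

definition tensor_map ::
  "('a::complex_vector \<Rightarrow> 'c::complex_vector) \<Rightarrow> ('b::complex_vector \<Rightarrow> 'd::complex_vector) \<Rightarrow> 'a \<otimes> 'b \<Rightarrow> 'c \<otimes> 'd" where
  "tensor_map f g = tensor_lift (\<lambda>x y. f x \<otimes> g y)"

definition tensor_swap :: "'a::complex_vector \<otimes> 'b::complex_vector \<Rightarrow> 'b \<otimes> 'a" where
  "tensor_swap = tensor_lift (\<lambda>x y. y \<otimes> x)"

definition tensor_assoc ::
  "('a::complex_vector \<otimes> 'b::complex_vector) \<otimes> 'c::complex_vector \<Rightarrow> 'a \<otimes> 'b \<otimes> 'c" where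
  "tensor_assoc = tensor_lift (\<lambda>t z. tensor_lift (\<lambda>x y. x \<otimes> y \<otimes> z) t)"

definition tensor_mult ::
  "('a::complex_vector \<Rightarrow> 'a \<Rightarrow> 'a) \<Rightarrow> ('b::complex_vector \<Rightarrow> 'b \<Rightarrow> 'b) \<Rightarrow> 'a \<otimes> 'b \<Rightarrow> 'a \<otimes> 'b \<Rightarrow> 'a \<otimes> 'b" where
  "tensor_mult m n s t = tensor_lift (\<lambda>x y. tensor_lift (\<lambda>x' y'. m x x' \<otimes> n y y') t) s"

text \<open>The sum of \<open>f\<^sub>\<alpha> \<otimes> f\<^sup>\<alpha>\<close>, for any pair of dual bases of a finite-dimensional space.\<close>

definition canonical_element :: "'a::complex_vector \<otimes> 'a dual" where
  "canonical_element = (THE t. \<forall>B d. dual_bases B (\<lambda>b. b) d \<longrightarrow> t = (\<Sum>b\<in>B. b \<otimes> d b))"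

lemma dual_bases_expand:
  assumes "dual_bases I e e'"
  shows "x = (\<Sum>i\<in>I. \<langle>e' i, x\<rangle> *\<^sub>C e i)"
proof -
  have fin: "finite I" and d: "\<And>i j. i \<in> I \<Longrightarrow> j \<in> I \<Longrightarrow> \<langle>e' i, e j\<rangle> = (if i = j then 1 else 0)"
    using assms by (auto simp: dual_bases_def)
  have "x \<in> cvs.span (e ` I)"
    using assms by (simp add: dual_bases_def is_basis_def)
  then show ?thesis
  proof (induction rule: cvs.span_induct_alt)
    case base
    show ?case by (simp add: clinear_0[OF clinear_pairing])
  next
    case (step c v w)
    then obtain j where j: "j \<in> I" "v = e j" by auto
    have "(\<Sum>i\<in>I. \<langle>e' i, v\<rangle> *\<^sub>C e i) = (\<Sum>i\<in>I. if i = j then e j else 0)"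
      by (rule sum.cong) (auto simp: j d scaleC_one)
    also have "\<dots> = v" using fin j by simp
    finally have v: "(\<Sum>i\<in>I. \<langle>e' i, v\<rangle> *\<^sub>C e i) = v" .
    have "(\<Sum>i\<in>I. \<langle>e' i, c *\<^sub>C v + w\<rangle> *\<^sub>C e i)
        = c *\<^sub>C (\<Sum>i\<in>I. \<langle>e' i, v\<rangle> *\<^sub>C e i) + (\<Sum>i\<in>I. \<langle>e' i, w\<rangle> *\<^sub>C e i)"
      by (simp add: clinear_add[OF clinear_pairing] clinear_scale[OF clinear_pairing] scaleC_complex_def
          scaleC_add_left sum.distrib cvs.scale_sum_right scaleC_scaleC)
    with v step show ?case by simp
  qed
qed

lemma dual_bases_expand_dual:
  assumes "dual_bases I e e'"
  shows "\<xi> = (\<Sum>i\<in>I. \<langle>\<xi>, e i\<rangle> *\<^sub>C e' i)"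
proof -
  have "\<langle>\<xi>, x\<rangle> = \<langle>\<Sum>i\<in>I. \<langle>\<xi>, e i\<rangle> *\<^sub>C e' i, x\<rangle>" for x
  proof -
    have "\<langle>\<xi>, x\<rangle> = \<langle>\<xi>, \<Sum>i\<in>I. \<langle>e' i, x\<rangle> *\<^sub>C e i\<rangle>"
      by (rule arg_cong[OF dual_bases_expand[OF assms]])
    also have "\<dots> = \<langle>\<Sum>i\<in>I. \<langle>\<xi>, e i\<rangle> *\<^sub>C e' i, x\<rangle>"
      by (simp add: clinear_sum[OF clinear_pairing] clinear_scale[OF clinear_pairing] scaleC_complex_def
          pairing_sum mult.commute)
    finally show ?thesis .
  qed
  then show ?thesis by (rule dual_eqI)
qed

lemma dual_bases_sum_unique:
  fixes e :: "'i \<Rightarrow> 'a::complex_vector" and f :: "'j \<Rightarrow> 'a"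
  assumes e: "dual_bases I e e'" and f: "dual_bases J f f'"
  shows "(\<Sum>i\<in>I. e i \<otimes> e' i) = (\<Sum>j\<in>J. f j \<otimes> f' j)"
proof -
  have lin: "clinear ((\<otimes>) x)" "clinear (\<lambda>x. x \<otimes> y)" for x :: 'a and y :: "'a dual"
    using cbilinear_tens by (auto simp: cbilinear_def)
  have "(\<Sum>i\<in>I. e i \<otimes> e' i) = (\<Sum>i\<in>I. (\<Sum>j\<in>J. \<langle>f' j, e i\<rangle> *\<^sub>C f j) \<otimes> e' i)"
    by (intro sum.cong refl arg_cong2[where f="(\<otimes>)"] dual_bases_expand[OF f])
  also have "\<dots> = (\<Sum>i\<in>I. \<Sum>j\<in>J. \<langle>f' j, e i\<rangle> *\<^sub>C (f j \<otimes> e' i))"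
    by (simp add: clinear_sum[OF lin(2)] clinear_scale[OF lin(2)])
  also have "\<dots> = (\<Sum>j\<in>J. \<Sum>i\<in>I. \<langle>f' j, e i\<rangle> *\<^sub>C (f j \<otimes> e' i))"
    by (rule sum.swap)
  also have "\<dots> = (\<Sum>j\<in>J. f j \<otimes> (\<Sum>i\<in>I. \<langle>f' j, e i\<rangle> *\<^sub>C e' i))"
    by (simp add: clinear_sum[OF lin(1)] clinear_scale[OF lin(1)])
  also have "\<dots> = (\<Sum>j\<in>J. f j \<otimes> f' j)"
    by (intro sum.cong refl arg_cong2[where f="(\<otimes>)"] dual_bases_expand_dual[OF e, symmetric])
  finally show ?thesis .
qed

lemma canonical_element_eq:
  fixes e :: "'i \<Rightarrow> 'a::complex_vector"
  assumes "dual_bases I e e'"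
  shows "canonical_element = (\<Sum>i\<in>I. e i \<otimes> e' i)"
  unfolding canonical_element_def
proof (rule the_equality)
  show "\<forall>B d. dual_bases B (\<lambda>b. b) d \<longrightarrow> (\<Sum>i\<in>I. e i \<otimes> e' i) = (\<Sum>b\<in>B. b \<otimes> d b)"
    using dual_bases_sum_unique[OF assms] by blast
next
  fix t :: "'a \<otimes> 'a dual"
  assume t: "\<forall>B d. dual_bases B (\<lambda>b. b) d \<longrightarrow> t = (\<Sum>b\<in>B. b \<otimes> d b)"
  have inj: "inj_on e I" using assms by (simp add: dual_bases_def is_basis_def)
  have "dual_bases (e ` I) (\<lambda>b. b) (\<lambda>b. e' (the_inv_into I e b))"
    using assms by (auto simp: dual_bases_def is_basis_def the_inv_into_f_f dest: inj_onD)
  then show "t = (\<Sum>i\<in>I. e i \<otimes> e' i)"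
    using t dual_bases_sum_unique[OF _ assms] by blast
qed


section \<open>Bialgebras and Hopf algebras\<close>

record (overloaded) ('a::complex_vector) bialg =
  bmult :: "'a \<Rightarrow> 'a \<Rightarrow> 'a"
  bunit :: 'a
  bcomult :: "'a \<Rightarrow> 'a \<otimes> 'a"
  bcounit :: "'a \<Rightarrow> complex"

definition is_algebra :: "('a::complex_vector \<Rightarrow> 'a \<Rightarrow> 'a) \<Rightarrow> 'a \<Rightarrow> bool" where
  "is_algebra m u \<longleftrightarrow> cbilinear m \<and> (\<forall>x y z. m (m x y) z = m x (m y z)) \<and>
     (\<forall>x. m u x = x \<and> m x u = x)"

definition is_coalgebra :: "('a::complex_vector \<Rightarrow> 'a \<otimes> 'a) \<Rightarrow> ('a \<Rightarrow> complex) \<Rightarrow> bool" where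
  "is_coalgebra \<Delta> \<epsilon> \<longleftrightarrow> clinear \<Delta> \<and> clinear \<epsilon> \<and>
     (\<forall>x. tensor_assoc (tensor_map \<Delta> id (\<Delta> x)) = tensor_map id \<Delta> (\<Delta> x)) \<and>
     (\<forall>x. tensor_lift (\<lambda>y z. \<epsilon> y *\<^sub>C z) (\<Delta> x) = x) \<and>
     (\<forall>x. tensor_lift (\<lambda>y z. \<epsilon> z *\<^sub>C y) (\<Delta> x) = x)"

definition is_bialgebra :: "'a::complex_vector bialg \<Rightarrow> bool" where
  "is_bialgebra A \<longleftrightarrow>
     is_algebra (bmult A) (bunit A) \<and> is_coalgebra (bcomult A) (bcounit A) \<and>
     (\<forall>x y. bcomult A (bmult A x y) = tensor_mult (bmult A) (bmult A) (bcomult A x) (bcomult A y)) \<and>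
     bcomult A (bunit A) = bunit A \<otimes> bunit A \<and>
     (\<forall>x y. bcounit A (bmult A x y) = bcounit A x * bcounit A y) \<and>
     bcounit A (bunit A) = 1"

definition is_hopf_algebra :: "'a::complex_vector bialg \<Rightarrow> ('a \<Rightarrow> 'a) \<Rightarrow> bool" where
  "is_hopf_algebra A \<sigma> \<longleftrightarrow> is_bialgebra A \<and> clinear \<sigma> \<and>
     (\<forall>x. tensor_lift (\<lambda>y z. bmult A (\<sigma> y) z) (bcomult A x) = bcounit A x *\<^sub>C bunit A) \<and>
     (\<forall>x. tensor_lift (\<lambda>y z. bmult A y (\<sigma> z)) (bcomult A x) = bcounit A x *\<^sub>C bunit A)"

definition is_bialgebra_hom :: "'a::complex_vector bialg \<Rightarrow> 'b::complex_vector bialg \<Rightarrow> ('a \<Rightarrow> 'b) \<Rightarrow> bool" where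
  "is_bialgebra_hom A B f \<longleftrightarrow> clinear f \<and>
     (\<forall>x y. f (bmult A x y) = bmult B (f x) (f y)) \<and> f (bunit A) = bunit B \<and>
     (\<forall>x. bcomult B (f x) = tensor_map f f (bcomult A x)) \<and>
     (\<forall>x. bcounit B (f x) = bcounit A x)"

definition dual_mult :: "'a::complex_vector bialg \<Rightarrow> 'a dual \<Rightarrow> 'a dual \<Rightarrow> 'a dual" where
  "dual_mult A \<xi> \<eta> = Dual (\<lambda>x. tensor_lift (\<lambda>y z. \<langle>\<xi>, y\<rangle> * \<langle>\<eta>, z\<rangle>) (bcomult A x))"

text \<open>In finite dimension \<open>A\<^sup>* \<otimes> A\<^sup>*\<close> is the dual of \<open>A \<otimes> A\<close>, so the coproduct exists and is unique.\<close>

definition dual_comult :: "'a::complex_vector bialg \<Rightarrow> 'a dual \<Rightarrow> 'a dual \<otimes> 'a dual" where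
  "dual_comult A \<xi> =
     (THE t. \<forall>x y. tensor_lift (\<lambda>\<phi> \<psi>. \<langle>\<phi>, x\<rangle> * \<langle>\<psi>, y\<rangle>) t = \<langle>\<xi>, bmult A x y\<rangle>)"

definition dual_bialg :: "'a::complex_vector bialg \<Rightarrow> 'a dual bialg" where
  "dual_bialg A = \<lparr>bmult = dual_mult A, bunit = Dual (bcounit A),
     bcomult = dual_comult A, bcounit = (\<lambda>\<xi>. \<langle>\<xi>, bunit A\<rangle>)\<rparr>"

definition coop :: "'a::complex_vector bialg \<Rightarrow> 'a bialg" where
  "coop A = A\<lparr>bcomult := \<lambda>x. tensor_swap (bcomult A x)\<rparr>"

definition alg_inverse :: "('a \<Rightarrow> 'a \<Rightarrow> 'a) \<Rightarrow> 'a \<Rightarrow> 'a \<Rightarrow> 'a" where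
  "alg_inverse m u x = (THE y. m x y = u \<and> m y x = u)"


section \<open>The quantum double\<close>

definition Hminus :: "'a::complex_vector bialg \<Rightarrow> 'a dual bialg" where
  "Hminus A = coop (dual_bialg A)"

definition emb_plus :: "'a::complex_vector bialg \<Rightarrow> 'a \<Rightarrow> 'a \<otimes> 'a dual" where
  "emb_plus A x = x \<otimes> bunit (Hminus A)"

definition emb_minus :: "'a::complex_vector bialg \<Rightarrow> 'a dual \<Rightarrow> 'a \<otimes> 'a dual" where
  "emb_minus A \<xi> = bunit A \<otimes> \<xi>"

text \<open>The second and third conjuncts say that the left action of \<open>A\<close> and the right action of
  \<open>Hminus A\<close> by multiplication in \<open>D\<close> are the evident ones; the last one is
  \<open>\<langle>\<xi>\<^sub>1, x\<^sub>1\<rangle> \<xi>\<^sub>2 x\<^sub>2 = x\<^sub>1 \<xi>\<^sub>1 \<langle>\<xi>\<^sub>2, x\<^sub>2\<rangle>\<close>, with the coproduct of \<open>\<xi>\<close> taken in \<open>Hminus A\<close>.\<close>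

definition is_quantum_double :: "'a::complex_vector bialg \<Rightarrow> ('a \<otimes> 'a dual) bialg \<Rightarrow> bool" where
  "is_quantum_double A D \<longleftrightarrow> is_bialgebra D \<and>
     (\<forall>x z \<zeta>. bmult D (emb_plus A x) (z \<otimes> \<zeta>) = bmult A x z \<otimes> \<zeta>) \<and>
     (\<forall>z \<zeta> \<xi>. bmult D (z \<otimes> \<zeta>) (emb_minus A \<xi>) = z \<otimes> bmult (Hminus A) \<zeta> \<xi>) \<and>
     is_bialgebra_hom A D (emb_plus A) \<and>
     is_bialgebra_hom (Hminus A) D (emb_minus A) \<and>
     (\<forall>\<xi> x.
        tensor_lift (\<lambda>\<xi>\<^sub>1 \<xi>\<^sub>2. tensor_lift (\<lambda>x\<^sub>1 x\<^sub>2.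
          \<langle>\<xi>\<^sub>1, x\<^sub>1\<rangle> *\<^sub>C bmult D (emb_minus A \<xi>\<^sub>2) (emb_plus A x\<^sub>2)) (bcomult A x)) (bcomult (Hminus A) \<xi>)
      = tensor_lift (\<lambda>\<xi>\<^sub>1 \<xi>\<^sub>2. tensor_lift (\<lambda>x\<^sub>1 x\<^sub>2.
          \<langle>\<xi>\<^sub>2, x\<^sub>2\<rangle> *\<^sub>C bmult D (emb_plus A x\<^sub>1) (emb_minus A \<xi>\<^sub>1)) (bcomult A x)) (bcomult (Hminus A) \<xi>))"

text \<open>The element inverted here is the sum of \<open>e\<^sup>\<mu> \<otimes> e\<^sub>\<mu>\<close>.\<close>

definition universal_R ::
  "'a::complex_vector bialg \<Rightarrow> ('a \<otimes> 'a dual) bialg \<Rightarrow> ('a \<otimes> 'a dual) \<otimes> ('a \<otimes> 'a dual)" where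
  "universal_R A D =
     alg_inverse (tensor_mult (bmult D) (bmult D)) (bunit D \<otimes> bunit D)
       (tensor_map (emb_minus A) (emb_plus A) (tensor_swap canonical_element))"

definition universal_R_bar ::
  "'a::complex_vector bialg \<Rightarrow> ('a \<otimes> 'a dual) bialg \<Rightarrow> ('a \<otimes> 'a dual) \<otimes> ('a \<otimes> 'a dual)" where
  "universal_R_bar A D =
     alg_inverse (tensor_mult (bmult D) (bmult D)) (bunit D \<otimes> bunit D) (universal_R A D)"

definition is_involution :: "'h::complex_vector bialg \<Rightarrow> ('h \<Rightarrow> 'h) \<Rightarrow> bool" where
  "is_involution D \<tau> \<longleftrightarrow> clinear \<tau> \<and> (\<forall>h. \<tau> (\<tau> h) = h) \<and>
     (\<forall>h. bcomult D (\<tau> h) = tensor_map \<tau> \<tau> (bcomult D h)) \<and>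
     (\<forall>h. bcounit D (\<tau> h) = bcounit D h) \<and>
     (\<forall>h k. bmult D (\<tau> h) (\<tau> k) = \<tau> (bmult D k h)) \<and> \<tau> (bunit D) = bunit D"


section \<open>The reflection equation dual\<close>

definition left_act :: "'h::complex_vector bialg \<Rightarrow> 'h \<Rightarrow> 'h dual \<Rightarrow> 'h dual" where
  "left_act D h a = Dual (\<lambda>x. \<langle>a, bmult D x h\<rangle>)"

definition right_act :: "'h::complex_vector bialg \<Rightarrow> 'h dual \<Rightarrow> 'h \<Rightarrow> 'h dual" where
  "right_act D a h = Dual (\<lambda>x. \<langle>a, bmult D h x\<rangle>)"

text \<open>\<open>\<tau>(R\<^sub>1) \<triangleright> a\<close> times \<open>b \<triangleleft> R\<^sub>2\<close> in the convolution algebra, for \<open>R\<close> the inverse of the universal R-matrix.\<close>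

definition re_mult ::
  "'a::complex_vector bialg \<Rightarrow> ('a \<otimes> 'a dual) bialg \<Rightarrow> ('a \<otimes> 'a dual \<Rightarrow> 'a \<otimes> 'a dual) \<Rightarrow>
   ('a \<otimes> 'a dual) dual \<Rightarrow> ('a \<otimes> 'a dual) dual \<Rightarrow> ('a \<otimes> 'a dual) dual" where
  "re_mult A D \<tau> a b =
     tensor_lift (\<lambda>h k. dual_mult D (left_act D (\<tau> h) a) (right_act D b k)) (universal_R_bar A D)"

text \<open>The functional \<open>\<xi> \<otimes> x\<close> on the double, where \<open>x\<close> is viewed in the dual of \<open>Hminus A\<close>.\<close>

definition dual_tens :: "'a::complex_vector dual \<Rightarrow> 'a \<Rightarrow> ('a \<otimes> 'a dual) dual" where
  "dual_tens \<xi> x = Dual (tensor_lift (\<lambda>z \<zeta>. \<langle>\<xi>, z\<rangle> * \<langle>\<zeta>, x\<rangle>))"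

definition dual_emb_plus :: "'a::complex_vector bialg \<Rightarrow> 'a dual \<Rightarrow> ('a \<otimes> 'a dual) dual" where
  "dual_emb_plus A \<xi> = dual_tens \<xi> (bunit A)"

definition dual_emb_minus :: "'a::complex_vector bialg \<Rightarrow> 'a \<Rightarrow> ('a \<otimes> 'a dual) dual" where
  "dual_emb_minus A x = dual_tens (bunit (dual_bialg A)) x"

definition universal_S :: "('a::complex_vector \<otimes> 'a dual) \<otimes> ('a \<otimes> 'a dual) dual" where
  "universal_S = canonical_element"

end

theory Submission
  imports Defs
begin

text \<open>
  The element \<open>\<Theta> = \<Sum>\<^sub>\<mu> e\<^sup>\<mu> \<otimes> e\<^sub>\<mu>\<close> is invertible because convolution inverts the identity of \<open>H\<^sub>+\<close> by the antipode,
  so \<open>\<Theta>\<close> is the inverse R-matrix entering the product of the RE dual.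
  For \<open>b = 1 \<otimes> x\<close> one has \<open>b \<triangleleft> e\<^sub>\<mu> = \<epsilon>(e\<^sub>\<mu>) b\<close>; the twist therefore collapses to
  \<open>\<tau>(\<Sum>\<^sub>\<mu> \<epsilon>(e\<^sub>\<mu>) e\<^sup>\<mu>) = \<tau>(1) = 1\<close>, and the RE product of \<open>\<xi> \<otimes> 1\<close> with \<open>1 \<otimes> x\<close> is the ordinary
  convolution product, which equals \<open>\<xi> \<otimes> x\<close>. Since also \<open>e\<^sub>\<mu> e\<^sup>\<nu> = e\<^sub>\<mu> \<otimes> e\<^sup>\<nu>\<close> in the double, the product
  is the sum over the tensor product bases.
\<close>

section \<open>Linear and bilinear maps on tensor products\<close>

lemma clinear_compose: "clinear f \<Longrightarrow> clinear g \<Longrightarrow> clinear (\<lambda>x. g (f x))"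
  by (simp add: clinear_iff)

lemma cbilinear_clinear:
  assumes "cbilinear f"
  shows "clinear (f x)" "clinear (\<lambda>x. f x y)"
  using assms by (auto simp: cbilinear_def)

lemma cbilinearI:
  "(\<And>x. clinear (f x)) \<Longrightarrow> (\<And>y. clinear (\<lambda>x. f x y)) \<Longrightarrow> cbilinear f"
  by (simp add: cbilinear_def)

lemma cbilinear_compose:
  "cbilinear f \<Longrightarrow> clinear g \<Longrightarrow> clinear h \<Longrightarrow> cbilinear (\<lambda>x y. f (g x) (h y))"
  by (simp add: cbilinear_def clinear_iff)

lemma cbilinear_compose_clinear:
  "clinear g \<Longrightarrow> cbilinear f \<Longrightarrow> cbilinear (\<lambda>x y. g (f x y))"
  by (simp add: cbilinear_def clinear_iff)

lemma cbilinear_functionals: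
  fixes f :: "'a::complex_vector \<Rightarrow> complex" and g :: "'b::complex_vector \<Rightarrow> complex"
  assumes "clinear f" "clinear g"
  shows "cbilinear (\<lambda>x y. f x * g y)"
  using assms by (simp add: cbilinear_def clinear_iff scaleC_complex_def algebra_simps)

lemma cbilinear_scaleC:
  fixes f :: "'a::complex_vector \<Rightarrow> complex" and g :: "'b::complex_vector \<Rightarrow> 'c::complex_vector"
  assumes "clinear f" "clinear g"
  shows "cbilinear (\<lambda>x y. f x *\<^sub>C g y)" "cbilinear (\<lambda>y x. f x *\<^sub>C g y)"
  using assms
  by (simp_all add: cbilinear_def clinear_iff scaleC_complex_def algebra_simps
      scaleC_add_left scaleC_add_right scaleC_scaleC)

lemma clinear_pairing_left: "clinear (\<lambda>\<xi>. \<langle>\<xi>, x\<rangle>)"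
  by (simp add: clinear_iff scaleC_complex_def)

lemma cbilinear_sum:
  assumes "cbilinear f"
  shows "f (\<Sum>i\<in>I. a i) (\<Sum>j\<in>J. b j) = (\<Sum>i\<in>I. \<Sum>j\<in>J. f (a i) (b j))"
  by (simp add: clinear_sum[OF cbilinear_clinear(1)[OF assms]]
      clinear_sum[OF cbilinear_clinear(2)[OF assms]] sum.swap[of _ J I])

text \<open>Additivity and homogeneity in \<open>w\<close> are equations between maps linear in
  \<open>t\<close>, so pure tensors suffice. Bilinearity is required at every \<open>w\<close>
  because \<open>tensor_lift\<close> is 0 on a non-bilinear argument. Products defined through
  \<open>tensor_lift\<close> get their bilinearity from here.\<close>

lemma clinear_tensor_lift_param:
  assumes bil: "\<And>w. cbilinear (f w)" and lin: "\<And>x y. clinear (\<lambda>w. f w x y)"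
  shows "clinear (\<lambda>w. tensor_lift (f w) t)"
proof -
  note lift = clinear_tensor_lift tensor_lift_tens[OF bil]
  have "tensor_lift (f (v + w)) t = tensor_lift (f v) t + tensor_lift (f w) t" for v w
  proof (rule clinear_eq_on_tens[where t=t])
    show "tensor_lift (f (v + w)) (x \<otimes> y) = tensor_lift (f v) (x \<otimes> y) + tensor_lift (f w) (x \<otimes> y)" for x y
      unfolding lift(2) by (rule clinear_add[OF lin])
  qed (auto simp: clinear_iff clinear_add[OF lift(1)] clinear_scale[OF lift(1)] scaleC_add_right)
  moreover have "tensor_lift (f (c *\<^sub>C w)) t = c *\<^sub>C tensor_lift (f w) t" for c w
  proof (rule clinear_eq_on_tens[where t=t])
    show "tensor_lift (f (c *\<^sub>C w)) (x \<otimes> y) = c *\<^sub>C tensor_lift (f w) (x \<otimes> y)" for x y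
      unfolding lift(2) by (rule clinear_scale[OF lin])
  qed (auto simp: clinear_iff clinear_add[OF lift(1)] clinear_scale[OF lift(1)] scaleC_add_right
      scaleC_scaleC mult.commute)
  ultimately show ?thesis
    by (simp add: clinear_iff)
qed

lemma clinear_tensor_map: "clinear (tensor_map f g)"
  unfolding tensor_map_def by (rule clinear_tensor_lift)

lemma tensor_map_tens: "clinear f \<Longrightarrow> clinear g \<Longrightarrow> tensor_map f g (x \<otimes> y) = f x \<otimes> g y"
  unfolding tensor_map_def by (rule tensor_lift_tens) (rule cbilinear_compose[OF cbilinear_tens])

text \<open>A linear map on a tensor product is determined by pure tensors. Together with
  \<open>tensor_lift_compose\<close> this gives naturality of the lift in source and target, which
  stands in for Sweedler calculations.\<close>

lemma tensor_lift_map: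
  assumes "clinear f" "clinear g" "cbilinear B"
  shows "tensor_lift B (tensor_map f g t) = tensor_lift (\<lambda>x y. B (f x) (g y)) t"
  by (rule clinear_eq_on_tens[where t=t])
    (use assms in \<open>auto simp: tensor_map_tens tensor_lift_tens cbilinear_compose
      intro: clinear_compose clinear_tensor_map clinear_tensor_lift\<close>)

lemma tensor_lift_compose:
  assumes "clinear g" "cbilinear B"
  shows "g (tensor_lift B t) = tensor_lift (\<lambda>x y. g (B x y)) t"
  by (rule clinear_eq_on_tens[where t=t])
    (use assms in \<open>auto simp: tensor_lift_tens cbilinear_compose_clinear
      intro: clinear_compose clinear_tensor_lift\<close>)

section \<open>The tensor product of two algebras\<close>

lemma cbilinear_tensor_mult_inner:
  assumes "cbilinear m" "cbilinear n"
  shows "cbilinear (\<lambda>x' y'. m x x' \<otimes> n y y')"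
  by (intro cbilinear_compose[OF cbilinear_tens] cbilinear_clinear assms)

text \<open>\<open>tensor_mult\<close> lifts twice; the outer lift yields the intended product only
  if its argument is bilinear for an arbitrary tensor \<open>t\<close>, not just for pure
  ones.\<close>

lemma cbilinear_tensor_mult_outer:
  assumes "cbilinear m" "cbilinear n"
  shows "cbilinear (\<lambda>x y. tensor_lift (\<lambda>x' y'. m x x' \<otimes> n y y') t)"
proof (rule cbilinearI)
  show "clinear (\<lambda>y. tensor_lift (\<lambda>x' y'. m x x' \<otimes> n y y') t)" for x
    by (rule clinear_tensor_lift_param)
      (auto intro: cbilinear_tensor_mult_inner assms
        clinear_compose[OF cbilinear_clinear(2)[OF assms(2)] cbilinear_clinear(1)[OF cbilinear_tens]])
  show "clinear (\<lambda>x. tensor_lift (\<lambda>x' y'. m x x' \<otimes> n y y') t)" for y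
    by (rule clinear_tensor_lift_param)
      (auto intro: cbilinear_tensor_mult_inner assms
        clinear_compose[OF cbilinear_clinear(2)[OF assms(1)] cbilinear_clinear(2)[OF cbilinear_tens]])
qed

lemma tensor_mult_tens:
  assumes "cbilinear m" "cbilinear n"
  shows "tensor_mult m n (x \<otimes> y) (x' \<otimes> y') = m x x' \<otimes> n y y'"
  unfolding tensor_mult_def
  by (simp add: tensor_lift_tens cbilinear_tensor_mult_inner
      cbilinear_compose[OF cbilinear_tens] cbilinear_clinear(2) assms)

lemma cbilinear_tensor_mult:
  assumes "cbilinear m" "cbilinear n"
  shows "cbilinear (tensor_mult m n)"
proof (rule cbilinearI)
  show "clinear (\<lambda>s. tensor_mult m n s t)" for t
    unfolding tensor_mult_def by (rule clinear_tensor_lift)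
  show "clinear (tensor_mult m n s)" for s
    unfolding tensor_mult_def
    by (rule clinear_tensor_lift_param)
      (auto intro: cbilinear_tensor_mult_outer assms
        simp: tensor_lift_tens clinear_tensor_lift)
qed

text \<open>Associativity is trilinear, so three nested reductions to pure tensors leave
  associativity in each factor. The result makes two-sided inverses in the tensor square of the
  double unique.\<close>

lemma is_algebra_tensor_mult:
  assumes "is_algebra m u" "is_algebra n v"
  shows "is_algebra (tensor_mult m n) (u \<otimes> v)"
proof -
  have bil: "cbilinear m" "cbilinear n"
    using assms by (auto simp: is_algebra_def)
  note bilT = cbilinear_tensor_mult[OF bil]
  note lin1 = cbilinear_clinear(1)[OF bilT] and lin2 = cbilinear_clinear(2)[OF bilT]
  have "tensor_mult m n (tensor_mult m n r s) t = tensor_mult m n r (tensor_mult m n s t)" for r s t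
  proof (rule clinear_eq_on_tens[where t=r])
    fix x y
    show "tensor_mult m n (tensor_mult m n (x \<otimes> y) s) t = tensor_mult m n (x \<otimes> y) (tensor_mult m n s t)"
    proof (rule clinear_eq_on_tens[where t=s])
      fix x' y'
      show "tensor_mult m n (tensor_mult m n (x \<otimes> y) (x' \<otimes> y')) t
          = tensor_mult m n (x \<otimes> y) (tensor_mult m n (x' \<otimes> y') t)"
        by (rule clinear_eq_on_tens[where t=t])
          (use assms in \<open>auto simp: tensor_mult_tens[OF bil] is_algebra_def
            intro: lin1 clinear_compose[OF lin1 lin1]\<close>)
    qed (auto intro: clinear_compose lin1 lin2)
  qed (auto intro: clinear_compose[OF lin2 lin2] lin2)
  moreover have "tensor_mult m n (u \<otimes> v) t = t" "tensor_mult m n t (u \<otimes> v) = t" for t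
    by (rule clinear_eq_on_tens[where t=t];
        use assms in \<open>auto simp: tensor_mult_tens[OF bil] is_algebra_def lin1 lin2 clinear_iff[of "\<lambda>x. x"]\<close>)+
  ultimately show ?thesis
    using bilT by (simp add: is_algebra_def)
qed

text \<open>Any other inverse satisfies \<open>z = z (x y) = (z x) y = y\<close>, so the definite
  description picks out \<open>y\<close>.\<close>

lemma alg_inverse_eq:
  assumes "is_algebra m u" "m x y = u" "m y x = u"
  shows "alg_inverse m u x = y"
  unfolding alg_inverse_def
proof (rule the_equality)
  fix z assume "m x z = u \<and> m z x = u"
  moreover have "m (m z x) y = m z (m x y)" "m z u = z" "m u y = y"
    using assms(1) by (simp_all add: is_algebra_def)
  ultimately show "z = y"
    using assms(2) by simp
qed (use assms in simp)

section \<open>Dual bases of the double\<close>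

text \<open>Biorthogonality forces injectivity and independence: equal vectors at different indices
  would make a pairing both 0 and 1, and pairing a linear relation with \<open>e' j\<close> reads
  off its coefficient at \<open>e j\<close>.\<close>

lemma dual_basesI:
  assumes fin: "finite I" and span: "cvs.span (e ` I) = UNIV"
    and d: "\<And>i j. i \<in> I \<Longrightarrow> j \<in> I \<Longrightarrow> \<langle>e' i, e j\<rangle> = (if i = j then 1 else 0)"
  shows "dual_bases I e e'"
proof -
  have inj: "inj_on e I"
    by (rule inj_onI) (metis d zero_neq_one)
  have "c (e j) = 0" if "(\<Sum>v\<in>e ` I. c v *\<^sub>C v) = 0" "j \<in> I" for c j
  proof -
    have "0 = \<langle>e' j, \<Sum>i\<in>I. c (e i) *\<^sub>C e i\<rangle>"
      using that(1) by (simp add: sum.reindex[OF inj] clinear_0[OF clinear_pairing])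
    also have "\<dots> = (\<Sum>i\<in>I. if j = i then c (e i) else 0)"
      unfolding clinear_sum[OF clinear_pairing]
      by (rule sum.cong)
        (auto simp: clinear_scale[OF clinear_pairing] scaleC_complex_def d[OF that(2)])
    also have "\<dots> = c (e j)"
      using fin that(2) by simp
    finally show ?thesis ..
  qed
  then have "cvs.independent (e ` I)"
    by (intro cvs.independent_if_scalars_zero) (auto simp: fin)
  then show ?thesis
    using fin span d inj by (simp add: dual_bases_def is_basis_def)
qed

lemma clinear_dualI: "(\<And>x. clinear (\<lambda>w. \<langle>f w, x\<rangle>)) \<Longrightarrow> clinear f"
  by (simp add: clinear_iff scaleC_complex_def dual_eqI)

lemma pairing_dual_tens: "\<langle>dual_tens \<xi> x, z \<otimes> \<zeta>\<rangle> = \<langle>\<xi>, z\<rangle> * \<langle>\<zeta>, x\<rangle>"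
  unfolding dual_tens_def
  by (simp add: pairing_Dual clinear_tensor_lift tensor_lift_tens cbilinear_functionals
      clinear_pairing clinear_pairing_left)

lemma pairing_dual_emb_plus: "\<langle>dual_emb_plus A \<xi>, z \<otimes> \<zeta>\<rangle> = \<langle>\<xi>, z\<rangle> * \<langle>\<zeta>, bunit A\<rangle>"
  by (simp add: dual_emb_plus_def pairing_dual_tens)

lemma pairing_dual_emb_minus:
  "clinear (bcounit A) \<Longrightarrow> \<langle>dual_emb_minus A x, z \<otimes> \<zeta>\<rangle> = bcounit A z * \<langle>\<zeta>, x\<rangle>"
  by (simp add: dual_emb_minus_def pairing_dual_tens dual_bialg_def pairing_Dual)

text \<open>\<open>dual_tens\<close> pairs with a pure tensor as a product of two pairings, so
  biorthogonality is inherited from the factors. The second factor of the double is itself a dual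
  space, and the \<open>e j\<close>, acting by evaluation, are dual to the
  \<open>e' j\<close>.\<close>

lemma dual_bases_tensor:
  fixes e :: "'i \<Rightarrow> 'a::complex_vector"
  assumes "dual_bases I e e'"
  shows "dual_bases (I \<times> I) (\<lambda>(i, j). e i \<otimes> e' j) (\<lambda>(i, j). dual_tens (e' i) (e j))"
proof (rule dual_basesI)
  show "finite (I \<times> I)"
    using assms by (simp add: dual_bases_def)
  let ?E = "(\<lambda>(i, j). e i \<otimes> e' j) ` (I \<times> I)"
  have "x \<otimes> \<xi> \<in> cvs.span ?E" for x \<xi>
  proof -
    have "x \<otimes> \<xi> = (\<Sum>i\<in>I. \<langle>e' i, x\<rangle> *\<^sub>C e i) \<otimes> (\<Sum>j\<in>I. \<langle>\<xi>, e j\<rangle> *\<^sub>C e' j)"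
      by (intro arg_cong2[where f="(\<otimes>)"] dual_bases_expand[OF assms] dual_bases_expand_dual[OF assms])
    also have "\<dots> = (\<Sum>i\<in>I. \<Sum>j\<in>I. \<langle>e' i, x\<rangle> *\<^sub>C \<langle>\<xi>, e j\<rangle> *\<^sub>C (e i \<otimes> e' j))"
      unfolding cbilinear_sum[OF cbilinear_tens]
      by (simp add: clinear_scale[OF cbilinear_clinear(1)[OF cbilinear_tens]]
          clinear_scale[OF cbilinear_clinear(2)[OF cbilinear_tens]] scaleC_scaleC mult.commute)
    also have "\<dots> \<in> cvs.span ?E"
      by (intro cvs.span_sum cvs.span_scale cvs.span_base) auto
    finally show ?thesis .
  qed
  then have "cvs.span {x \<otimes> \<xi> | x \<xi>. True} \<subseteq> cvs.span ?E"
    by (intro cvs.span_minimal) auto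
  then show "cvs.span ?E = UNIV"
    unfolding tensor_span by auto
next
  fix p q assume "p \<in> I \<times> I" "q \<in> I \<times> I"
  moreover have "\<langle>e' i, e j\<rangle> = (if i = j then 1 else 0)" if "i \<in> I" "j \<in> I" for i j
    using assms that by (simp add: dual_bases_def)
  ultimately show "\<langle>case p of (i, j) \<Rightarrow> dual_tens (e' i) (e j), case q of (i, j) \<Rightarrow> e i \<otimes> e' j\<rangle>
      = (if p = q then 1 else 0)"
    by (auto simp: pairing_dual_tens split: if_splits)
qed

section \<open>Convolution and the inverse R-matrix\<close>

lemma pairing_dual_mult:
  assumes "clinear (bcomult A)"
  shows "\<langle>dual_mult A \<xi> \<eta>, x\<rangle> = tensor_lift (\<lambda>y z. \<langle>\<xi>, y\<rangle> * \<langle>\<eta>, z\<rangle>) (bcomult A x)"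
  unfolding dual_mult_def
  by (rule pairing_Dual) (rule clinear_compose[OF assms clinear_tensor_lift])

lemma cbilinear_dual_mult:
  assumes "clinear (bcomult A)"
  shows "cbilinear (dual_mult A)"
proof (rule cbilinearI)
  note bil = cbilinear_functionals[OF clinear_pairing clinear_pairing]
  have *: "clinear (\<lambda>\<eta>. tensor_lift (\<lambda>y z. \<langle>\<xi>, y\<rangle> * \<langle>\<eta>, z\<rangle>) t)"
    "clinear (\<lambda>\<eta>. tensor_lift (\<lambda>y z. \<langle>\<eta>, y\<rangle> * \<langle>\<xi>, z\<rangle>) t)" for \<xi> :: "'a dual" and t
    by (rule clinear_tensor_lift_param, rule bil,
        simp add: clinear_iff scaleC_complex_def algebra_simps)+
  show "clinear (dual_mult A \<xi>)" "clinear (\<lambda>\<xi>. dual_mult A \<xi> \<eta>)" for \<xi> \<eta>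
    by (rule clinear_dualI; unfold pairing_dual_mult[OF assms]; rule *)+
qed

text \<open>The convolution product is the transpose of the coproduct: the coefficient of
  \<open>e' k\<close> in the product of \<open>e' i\<close> and \<open>e' j\<close> is the
  coordinate of \<open>bcomult A (e k)\<close> at \<open>e i \<otimes> e j\<close>. Read as a linear
  map on \<open>A\<close>, the sum is therefore the coproduct followed by \<open>B\<close>.\<close>

lemma sum_convolution_dual_bases:
  assumes db: "dual_bases I e e'" and co: "clinear (bcomult A)" and B: "cbilinear B"
  shows "(\<Sum>i\<in>I. \<Sum>j\<in>I. dual_mult A (e' i) (e' j) \<otimes> B (e i) (e j))
    = (\<Sum>k\<in>I. e' k \<otimes> tensor_lift B (bcomult A (e k)))"
proof -
  note tl = cbilinear_clinear[OF cbilinear_tens]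
  note bil = cbilinear_functionals[OF clinear_pairing clinear_pairing]
  \<comment> \<open>The pairings with \<open>e' i\<close> and \<open>e' j\<close> are the
    coordinates of \<open>t\<close> with respect to the tensors
    \<open>e i \<otimes> e j\<close>.\<close>
  have expand: "(\<Sum>i\<in>I. \<Sum>j\<in>I. tensor_lift (\<lambda>y z. \<langle>e' i, y\<rangle> * \<langle>e' j, z\<rangle>) t *\<^sub>C B (e i) (e j))
      = tensor_lift B t" for t
  proof (rule clinear_eq_on_tens[where t=t])
    show "clinear (\<lambda>t. \<Sum>i\<in>I. \<Sum>j\<in>I. tensor_lift (\<lambda>y z. \<langle>e' i, y\<rangle> * \<langle>e' j, z\<rangle>) t *\<^sub>C B (e i) (e j))"
      by (simp add: clinear_iff clinear_add[OF clinear_tensor_lift] clinear_scale[OF clinear_tensor_lift]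
          scaleC_add_left scaleC_complex_def sum.distrib cvs.scale_sum_right)
    fix y z
    have "B y z = B (\<Sum>i\<in>I. \<langle>e' i, y\<rangle> *\<^sub>C e i) (\<Sum>j\<in>I. \<langle>e' j, z\<rangle> *\<^sub>C e j)"
      by (intro arg_cong2[where f=B] dual_bases_expand[OF db])
    also have "\<dots> = (\<Sum>i\<in>I. \<Sum>j\<in>I. (\<langle>e' i, y\<rangle> * \<langle>e' j, z\<rangle>) *\<^sub>C B (e i) (e j))"
      unfolding cbilinear_sum[OF B]
      by (simp add: clinear_scale[OF cbilinear_clinear(1)[OF B]]
          clinear_scale[OF cbilinear_clinear(2)[OF B]] scaleC_scaleC mult.commute)
    finally show "(\<Sum>i\<in>I. \<Sum>j\<in>I. tensor_lift (\<lambda>y z. \<langle>e' i, y\<rangle> * \<langle>e' j, z\<rangle>) (y \<otimes> z) *\<^sub>C B (e i) (e j))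
        = tensor_lift B (y \<otimes> z)"
      by (simp add: tensor_lift_tens B bil)
  qed (rule clinear_tensor_lift)
  \<comment> \<open>Expanding in the basis \<open>e'\<close> and moving the coefficient to the right
    tensor factor lets \<open>expand\<close> collapse the sums over \<open>i\<close> and
    \<open>j\<close> for each fixed \<open>k\<close>.\<close>
  have "dual_mult A (e' i) (e' j) \<otimes> B (e i) (e j)
      = (\<Sum>k\<in>I. e' k \<otimes> \<langle>dual_mult A (e' i) (e' j), e k\<rangle> *\<^sub>C B (e i) (e j))" for i j
    by (subst dual_bases_expand_dual[OF db, of "dual_mult A (e' i) (e' j)"])
      (simp add: clinear_sum[OF tl(2)] clinear_scale[OF tl(2)] clinear_scale[OF tl(1)])
  then have "(\<Sum>i\<in>I. \<Sum>j\<in>I. dual_mult A (e' i) (e' j) \<otimes> B (e i) (e j))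
      = (\<Sum>i\<in>I. \<Sum>j\<in>I. \<Sum>k\<in>I. e' k \<otimes> \<langle>dual_mult A (e' i) (e' j), e k\<rangle> *\<^sub>C B (e i) (e j))"
    by simp
  also have "\<dots> = (\<Sum>i\<in>I. \<Sum>k\<in>I. \<Sum>j\<in>I. e' k \<otimes> \<langle>dual_mult A (e' i) (e' j), e k\<rangle> *\<^sub>C B (e i) (e j))"
    by (rule sum.cong[OF refl], rule sum.swap)
  also have "\<dots> = (\<Sum>k\<in>I. \<Sum>i\<in>I. \<Sum>j\<in>I. e' k \<otimes> \<langle>dual_mult A (e' i) (e' j), e k\<rangle> *\<^sub>C B (e i) (e j))"
    by (rule sum.swap)
  also have "\<dots> = (\<Sum>k\<in>I. e' k \<otimes> tensor_lift B (bcomult A (e k)))"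
    by (simp add: clinear_sum[OF tl(1), symmetric] pairing_dual_mult[OF co] expand)
  finally show ?thesis .
qed

text \<open>Only the coproduct is reversed in \<open>Hminus A\<close>; the rest is the structure of
  the dual. In particular its unit is the counit of \<open>A\<close>, seen as a functional.\<close>

lemma Hminus_simps:
  "bmult (Hminus A) = dual_mult A" "bunit (Hminus A) = Dual (bcounit A)"
  "bcounit (Hminus A) = (\<lambda>\<xi>. \<langle>\<xi>, bunit A\<rangle>)"
  by (simp_all add: Hminus_def coop_def dual_bialg_def)

lemma quantum_doubleD:
  assumes "is_quantum_double A D"
  shows "is_bialgebra D" "is_bialgebra_hom A D (emb_plus A)" "is_bialgebra_hom (Hminus A) D (emb_minus A)"
    and "bmult D (emb_plus A x) (z \<otimes> \<zeta>) = bmult A x z \<otimes> \<zeta>"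
  using assms by (simp_all add: is_quantum_double_def)

lemma universal_R_bar_eq:
  fixes e :: "'i \<Rightarrow> 'a::complex_vector"
  assumes hopf: "is_hopf_algebra A \<sigma>" and qd: "is_quantum_double A D" and db: "dual_bases I e e'"
  shows "universal_R_bar A D = (\<Sum>i\<in>I. emb_minus A (e' i) \<otimes> emb_plus A (e i))"
proof -
  note hp = quantum_doubleD(2)[OF qd, unfolded is_bialgebra_hom_def]
  note hm = quantum_doubleD(3)[OF qd, unfolded is_bialgebra_hom_def]
  have lin: "clinear (emb_minus A)" "clinear (emb_plus A)" "clinear \<sigma>" "clinear (bcomult A)"
      "clinear (bcounit A)" and mA: "cbilinear (bmult A)"
    using hp hm hopf by (auto simp: is_hopf_algebra_def is_bialgebra_def is_coalgebra_def is_algebra_def)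
  have algD: "is_algebra (bmult D) (bunit D)"
    using quantum_doubleD(1)[OF qd] by (simp add: is_bialgebra_def)
  then have mD: "cbilinear (bmult D)"
    by (simp add: is_algebra_def)
  note alg = is_algebra_tensor_mult[OF algD algD]
  define T where "T = (\<Sum>i\<in>I. emb_minus A (e' i) \<otimes> emb_plus A (e i))"
  \<comment> \<open>The candidate for \<open>universal_R\<close>: the antipode, as convolution
    inverse of the identity, is applied in the second leg.\<close>
  define T' where "T' = (\<Sum>i\<in>I. emb_minus A (e' i) \<otimes> emb_plus A (\<sigma> (e i)))"
  let ?m = "tensor_mult (bmult D) (bmult D)"
  \<comment> \<open>Stated for general \<open>f\<close> and \<open>g\<close> so that identity and
    antipode can be inserted in either order, giving both sides of the inverse.\<close>
  have conv: "(\<Sum>i\<in>I. \<Sum>j\<in>I. ?m (emb_minus A (e' i) \<otimes> emb_plus A (f (e i)))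
        (emb_minus A (e' j) \<otimes> emb_plus A (g (e j)))) = bunit D \<otimes> bunit D"
    if fg: "clinear f" "clinear g"
      and inv: "\<And>x. tensor_lift (\<lambda>y z. bmult A (f y) (g z)) (bcomult A x) = bcounit A x *\<^sub>C bunit A"
    for f g
  proof -
    note tl = cbilinear_clinear[OF cbilinear_tens]
    have "(\<Sum>i\<in>I. \<Sum>j\<in>I. ?m (emb_minus A (e' i) \<otimes> emb_plus A (f (e i)))
        (emb_minus A (e' j) \<otimes> emb_plus A (g (e j))))
      = tensor_map (emb_minus A) (emb_plus A)
          (\<Sum>i\<in>I. \<Sum>j\<in>I. dual_mult A (e' i) (e' j) \<otimes> bmult A (f (e i)) (g (e j)))"
      using hp hm by (simp add: tensor_mult_tens[OF mD mD] clinear_sum[OF clinear_tensor_map]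
          tensor_map_tens Hminus_simps)
    also have "(\<Sum>i\<in>I. \<Sum>j\<in>I. dual_mult A (e' i) (e' j) \<otimes> bmult A (f (e i)) (g (e j)))
      = (\<Sum>k\<in>I. e' k \<otimes> (bcounit A (e k) *\<^sub>C bunit A))"
      using sum_convolution_dual_bases[OF db lin(4) cbilinear_compose[OF mA fg]] by (simp add: inv)
    \<comment> \<open>The coefficients \<open>bcounit A (e k)\<close> are moved to the left leg,
      where they assemble the functional \<epsilon>, the unit of \<open>Hminus A\<close>.\<close>
    also have "\<dots> = (\<Sum>k\<in>I. \<langle>Dual (bcounit A), e k\<rangle> *\<^sub>C e' k) \<otimes> bunit A"
      by (simp add: clinear_sum[OF tl(2)] clinear_scale[OF tl(2)] clinear_scale[OF tl(1)]
          pairing_Dual lin(5))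
    also have "\<dots> = Dual (bcounit A) \<otimes> bunit A"
      by (simp only: dual_bases_expand_dual[OF db, of "Dual (bcounit A)", symmetric])
    finally show ?thesis
      using hp hm by (simp add: tensor_map_tens Hminus_simps)
  qed
  note bilT = cbilinear_tensor_mult[OF mD mD]
  have id: "clinear (\<lambda>x::'a. x)"
    by (simp add: clinear_iff)
  have "?m T T' = bunit D \<otimes> bunit D"
    unfolding T_def T'_def cbilinear_sum[OF bilT]
    by (rule conv[OF id lin(3)]) (use hopf in \<open>simp add: is_hopf_algebra_def\<close>)
  moreover have "?m T' T = bunit D \<otimes> bunit D"
    unfolding T_def T'_def cbilinear_sum[OF bilT]
    by (rule conv[OF lin(3) id]) (use hopf in \<open>simp add: is_hopf_algebra_def\<close>)
  moreover have "universal_R A D = alg_inverse ?m (bunit D \<otimes> bunit D) T"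
  proof -
    have swap: "tensor_swap (x \<otimes> \<xi>) = \<xi> \<otimes> x" for x :: 'a and \<xi> :: "'a dual"
      unfolding tensor_swap_def
      by (rule tensor_lift_tens) (auto intro: cbilinearI cbilinear_clinear[OF cbilinear_tens])
    have linswap: "clinear (tensor_swap :: 'a \<otimes> 'a dual \<Rightarrow> _)"
      unfolding tensor_swap_def by (rule clinear_tensor_lift)
    show ?thesis
      unfolding universal_R_def canonical_element_eq[OF db] T_def
      by (simp add: clinear_sum[OF linswap] swap clinear_sum[OF clinear_tensor_map] tensor_map_tens lin)
  qed
  \<comment> \<open>Inverting \<open>T\<close> gives \<open>T'\<close>, which is
    \<open>universal_R\<close>; inverting once more returns \<open>T\<close>.\<close>
  ultimately show ?thesis
    unfolding universal_R_bar_def T_def[symmetric] by (simp add: alg_inverse_eq[OF alg])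
qed

section \<open>The two factors in the double and in its convolution algebra\<close>

text \<open>The functional is \<epsilon> on the first factor times evaluation at \<open>x\<close> on
  the second. Left multiplication by \<open>emb_plus A y\<close> changes only the first factor,
  where \<epsilon> is multiplicative.\<close>

lemma right_act_dual_emb_minus:
  assumes A: "is_bialgebra A" and qd: "is_quantum_double A D"
  shows "right_act D (dual_emb_minus A x) (emb_plus A y) = bcounit A y *\<^sub>C dual_emb_minus A x"
proof (rule dual_eqI)
  fix h
  have mD: "cbilinear (bmult D)"
    using quantum_doubleD(1)[OF qd] by (simp add: is_bialgebra_def is_algebra_def)
  have eps: "clinear (bcounit A)" "\<And>y z. bcounit A (bmult A y z) = bcounit A y * bcounit A z"
    using A by (auto simp: is_bialgebra_def is_coalgebra_def)
  have lin: "clinear (\<lambda>h. \<langle>dual_emb_minus A x, bmult D (emb_plus A y) h\<rangle>)"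
    by (rule clinear_compose[OF cbilinear_clinear(1)[OF mD] clinear_pairing])
  have "\<langle>dual_emb_minus A x, bmult D (emb_plus A y) h\<rangle> = \<langle>bcounit A y *\<^sub>C dual_emb_minus A x, h\<rangle>"
    by (rule clinear_eq_on_tens[where t=h, OF lin clinear_pairing])
      (simp add: quantum_doubleD(4)[OF qd] pairing_dual_emb_minus eps)
  then show "\<langle>right_act D (dual_emb_minus A x) (emb_plus A y), h\<rangle> = \<langle>bcounit A y *\<^sub>C dual_emb_minus A x, h\<rangle>"
    unfolding right_act_def by (simp add: pairing_Dual lin)
qed

text \<open>This is the left action of \<open>A\<close> on \<open>bunit A \<otimes> \<xi>\<close>.
  It turns every pure tensor of the double into a product, to which multiplicativity of the
  coproduct applies.\<close>

lemma emb_plus_mult_emb_minus: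
  assumes "is_bialgebra A" "is_quantum_double A D"
  shows "bmult D (emb_plus A x) (emb_minus A \<xi>) = x \<otimes> \<xi>"
  using assms quantum_doubleD(4)[OF assms(2), of x "bunit A" \<xi>]
  by (simp add: emb_minus_def is_bialgebra_def is_algebra_def)

text \<open>The coproduct of a product of the two factors is the product of their coproducts.
  Pairing with the two functionals separates the factors, and the counit axioms of \<open>A\<close>
  and \<open>Hminus A\<close> reduce them to \<langle>\<xi>, z\<rangle> and \<langle>\<zeta>,
  x\<rangle>.\<close>

lemma dual_mult_dual_emb:
  assumes A: "is_bialgebra A" and qd: "is_quantum_double A D"
  shows "dual_mult D (dual_emb_plus A \<xi>) (dual_emb_minus A x) = dual_tens \<xi> x"
proof (rule dual_eqI)
  fix h
  note hp = quantum_doubleD(2)[OF qd, unfolded is_bialgebra_hom_def]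
  note hm = quantum_doubleD(3)[OF qd, unfolded is_bialgebra_hom_def]
  have D: "cbilinear (bmult D)" "clinear (bcomult D)" "clinear (bcounit D)"
    "\<And>h. tensor_lift (\<lambda>y z. bcounit D y *\<^sub>C z) (bcomult D h) = h"
    "\<And>h k. bcomult D (bmult D h k) = tensor_mult (bmult D) (bmult D) (bcomult D h) (bcomult D k)"
    using quantum_doubleD(1)[OF qd] by (auto simp: is_bialgebra_def is_algebra_def is_coalgebra_def)
  have A': "clinear (bcounit A)" "bcounit A (bunit A) = 1"
    "\<And>x. tensor_lift (\<lambda>y z. bcounit A z *\<^sub>C y) (bcomult A x) = x"
    using A by (auto simp: is_bialgebra_def is_coalgebra_def)
  have id: "clinear (\<lambda>x::'b::complex_vector. x)"
    by (simp add: clinear_iff)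
  let ?a = "dual_emb_plus A \<xi>" and ?b = "dual_emb_minus A x"
  define F where "F = tensor_lift (\<lambda>y z. \<langle>?a, y\<rangle> * \<langle>?b, z\<rangle>)"
  define L where "L = tensor_lift (\<lambda>y z. \<langle>\<xi>, y\<rangle> * bcounit A z)"
  define M where "M = tensor_lift (\<lambda>\<zeta> \<eta>. \<langle>\<zeta>, bunit A\<rangle> * \<langle>\<eta>, x\<rangle>)"
  have bilF: "cbilinear (\<lambda>y z. \<langle>?a, y\<rangle> * \<langle>?b, z\<rangle>)"
    by (rule cbilinear_functionals[OF clinear_pairing clinear_pairing])
  have bilL: "cbilinear (\<lambda>y z. \<langle>\<xi>, y\<rangle> * bcounit A z)"
    by (rule cbilinear_functionals[OF clinear_pairing A'(1)])
  have bilM: "cbilinear (\<lambda>\<zeta> \<eta>. \<langle>\<zeta>, bunit A\<rangle> * \<langle>\<eta>, x\<rangle>)"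
    by (rule cbilinear_functionals[OF clinear_pairing_left clinear_pairing_left])
  have linF: "clinear F" and linL: "clinear L" and linM: "clinear M"
    unfolding F_def L_def M_def by (rule clinear_tensor_lift)+
  note bilT = cbilinear_tensor_mult[OF D(1) D(1)]
  \<comment> \<open>On pure tensors the product is
    \<open>(y \<otimes> \<zeta>) \<otimes> (z \<otimes> \<eta>)\<close>. Here \<open>?a\<close>
    contributes \<open>\<langle>\<xi>, y\<rangle> * \<langle>\<zeta>, bunit A\<rangle>\<close> and
    \<open>?b\<close> contributes \<open>bcounit A z * \<langle>\<eta>, x\<rangle>\<close>;
    regrouping separates \<open>s\<close> from \<open>t\<close>.\<close>
  have split: "F (tensor_mult (bmult D) (bmult D) (tensor_map (emb_plus A) (emb_plus A) s)
      (tensor_map (emb_minus A) (emb_minus A) t)) = L s * M t" for s t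
  proof (rule clinear_eq_on_tens[where t=s])
    fix y z
    show "F (tensor_mult (bmult D) (bmult D) (tensor_map (emb_plus A) (emb_plus A) (y \<otimes> z))
        (tensor_map (emb_minus A) (emb_minus A) t)) = L (y \<otimes> z) * M t"
    proof (rule clinear_eq_on_tens[where t=t])
      fix \<zeta> \<eta>
      show "F (tensor_mult (bmult D) (bmult D) (tensor_map (emb_plus A) (emb_plus A) (y \<otimes> z))
          (tensor_map (emb_minus A) (emb_minus A) (\<zeta> \<otimes> \<eta>))) = L (y \<otimes> z) * M (\<zeta> \<otimes> \<eta>)"
        using hp hm
        by (simp add: tensor_map_tens tensor_mult_tens[OF D(1) D(1)] F_def L_def M_def
            tensor_lift_tens[OF bilF] tensor_lift_tens[OF bilL] tensor_lift_tens[OF bilM]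
            emb_plus_mult_emb_minus[OF A qd] pairing_dual_emb_plus pairing_dual_emb_minus A'(1))
    next
      show "clinear (\<lambda>t. L (y \<otimes> z) * M t)"
        using linM by (simp add: clinear_iff scaleC_complex_def algebra_simps)
    qed (intro clinear_compose[OF clinear_compose[OF clinear_tensor_map cbilinear_clinear(1)[OF bilT]] linF])
  next
    show "clinear (\<lambda>s. L s * M t)"
      using linL by (simp add: clinear_iff scaleC_complex_def algebra_simps)
  qed (intro clinear_compose[OF clinear_compose[OF clinear_tensor_map cbilinear_clinear(2)[OF bilT]] linF])
  \<comment> \<open>This is \<xi> applied to the right counit axiom of \<open>A\<close>.\<close>
  have L: "L (bcomult A z) = \<langle>\<xi>, z\<rangle>" for z
    using tensor_lift_compose[OF clinear_pairing cbilinear_scaleC(2)[OF A'(1) id], of \<xi> "bcomult A z"]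
    by (simp add: L_def A'(3) clinear_scale[OF clinear_pairing] scaleC_complex_def mult.commute)
  \<comment> \<open>The counit axiom of \<open>Hminus A\<close> is read off from that of \<open>D\<close> along the embedding, which avoids
    the description of the coproduct of \<open>dual_bialg\<close>.\<close>
  have M: "M (bcomult (Hminus A) \<zeta>) = \<langle>\<zeta>, x\<rangle>" for \<zeta>
  proof -
    have bil: "cbilinear (\<lambda>\<zeta> \<eta>. \<langle>\<zeta>, bunit A\<rangle> *\<^sub>C emb_minus A \<eta>)"
      using cbilinear_scaleC(1)[OF clinear_pairing_left] hm by blast
    have "emb_minus A \<zeta> = tensor_lift (\<lambda>y z. bcounit D y *\<^sub>C z)
        (tensor_map (emb_minus A) (emb_minus A) (bcomult (Hminus A) \<zeta>))"
      using D(4)[of "emb_minus A \<zeta>"] hm by simp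
    also have "\<dots> = tensor_lift (\<lambda>\<zeta> \<eta>. \<langle>\<zeta>, bunit A\<rangle> *\<^sub>C emb_minus A \<eta>) (bcomult (Hminus A) \<zeta>)"
      using hm by (simp add: tensor_lift_map cbilinear_scaleC(1)[OF D(3) id] Hminus_simps)
    finally have "\<langle>?b, emb_minus A \<zeta>\<rangle>
        = tensor_lift (\<lambda>\<zeta> \<eta>. \<langle>?b, \<langle>\<zeta>, bunit A\<rangle> *\<^sub>C emb_minus A \<eta>\<rangle>) (bcomult (Hminus A) \<zeta>)"
      using tensor_lift_compose[OF clinear_pairing bil] by metis
    moreover have "\<langle>?b, emb_minus A \<eta>\<rangle> = \<langle>\<eta>, x\<rangle>" for \<eta>
      by (simp add: pairing_dual_emb_minus emb_minus_def A')
    ultimately show ?thesis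
      by (simp add: M_def clinear_scale[OF clinear_pairing] scaleC_complex_def)
  qed
  have lin: "clinear (\<lambda>h. F (bcomult D h))"
    by (rule clinear_compose[OF D(2) linF])
  have "F (bcomult D h) = \<langle>dual_tens \<xi> x, h\<rangle>"
  proof (rule clinear_eq_on_tens[where t=h, OF lin clinear_pairing])
    fix z \<zeta>
    have "F (bcomult D (z \<otimes> \<zeta>)) = F (bcomult D (bmult D (emb_plus A z) (emb_minus A \<zeta>)))"
      by (simp add: emb_plus_mult_emb_minus[OF A qd])
    also have "\<dots> = \<langle>\<xi>, z\<rangle> * \<langle>\<zeta>, x\<rangle>"
      using hp hm by (simp add: D(5) split L M)
    finally show "F (bcomult D (z \<otimes> \<zeta>)) = \<langle>dual_tens \<xi> x, z \<otimes> \<zeta>\<rangle>"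
      by (simp add: pairing_dual_tens)
  qed
  then show "\<langle>dual_mult D ?a ?b, h\<rangle> = \<langle>dual_tens \<xi> x, h\<rangle>"
    by (simp add: pairing_dual_mult[OF D(2)] F_def)
qed

section \<open>The product of the RE dual\<close>

lemma cbilinear_left_act:
  assumes "cbilinear (bmult D)"
  shows "cbilinear (left_act D)"
proof -
  note lin1 = cbilinear_clinear(1)[OF assms] and lin2 = cbilinear_clinear(2)[OF assms]
  have "\<langle>left_act D h a, x\<rangle> = \<langle>a, bmult D x h\<rangle>" for h a x
    unfolding left_act_def by (rule pairing_Dual) (rule clinear_compose[OF lin2 clinear_pairing])
  then show ?thesis
    by (intro cbilinearI clinear_dualI)
      (simp_all add: clinear_pairing_left clinear_compose[OF lin1 clinear_pairing])
qed

lemma cbilinear_right_act: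
  assumes "cbilinear (bmult D)"
  shows "cbilinear (right_act D)"
proof -
  note lin1 = cbilinear_clinear(1)[OF assms] and lin2 = cbilinear_clinear(2)[OF assms]
  have "\<langle>right_act D a h, x\<rangle> = \<langle>a, bmult D h x\<rangle>" for h a x
    unfolding right_act_def by (rule pairing_Dual) (rule clinear_compose[OF lin1 clinear_pairing])
  then show ?thesis
    by (intro cbilinearI clinear_dualI)
      (simp_all add: clinear_pairing_left clinear_compose[OF lin2 clinear_pairing])
qed

text \<open>\<open>re_mult\<close> lifts this map along the inverse R-matrix; bilinearity guarantees
  that the lift is the intended one and not the default 0.\<close>

lemma cbilinear_re_mult_inner:
  assumes "is_bialgebra D" "clinear \<tau>"
  shows "cbilinear (\<lambda>h k. dual_mult D (left_act D (\<tau> h) a) (right_act D b k))"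
proof -
  have "cbilinear (bmult D)" "clinear (bcomult D)"
    using assms(1) by (auto simp: is_bialgebra_def is_algebra_def is_coalgebra_def)
  then show ?thesis
    by (intro cbilinear_compose[OF cbilinear_dual_mult] cbilinear_clinear(1)[OF cbilinear_right_act]
        clinear_compose[OF assms(2) cbilinear_clinear(2)[OF cbilinear_left_act]])
qed

text \<open>The inverse R-matrix is a fixed tensor and the two factors are parameters of the lifted
  map, so \<open>clinear_tensor_lift_param\<close> applies to each of them.\<close>

lemma cbilinear_re_mult:
  assumes D: "is_bialgebra D" and \<tau>: "clinear \<tau>"
  shows "cbilinear (re_mult A D \<tau>)"
proof -
  have *: "cbilinear (bmult D)" "clinear (bcomult D)"
    using D by (auto simp: is_bialgebra_def is_algebra_def is_coalgebra_def)
  note dm = cbilinear_clinear[OF cbilinear_dual_mult[OF *(2)]]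
  show ?thesis
    unfolding re_mult_def
    by (intro cbilinearI clinear_tensor_lift_param cbilinear_re_mult_inner[OF assms]
        clinear_compose[OF cbilinear_clinear(1)[OF cbilinear_left_act[OF *(1)]] dm(2)]
        clinear_compose[OF cbilinear_clinear(2)[OF cbilinear_right_act[OF *(1)]] dm(1)])
qed

lemma re_mult_dual_emb:
  fixes A :: "'a::complex_vector bialg" and e :: "'i \<Rightarrow> 'a"
  assumes hopf: "is_hopf_algebra A \<sigma>" and qd: "is_quantum_double A D" and \<tau>: "is_involution D \<tau>"
    and db: "dual_bases I e e'"
  shows "re_mult A D \<tau> (dual_emb_plus A \<xi>) (dual_emb_minus A x) = dual_tens \<xi> x"
proof -
  let ?a = "dual_emb_plus A \<xi>" and ?b = "dual_emb_minus A x"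
  note hm = quantum_doubleD(3)[OF qd, unfolded is_bialgebra_hom_def]
  have D: "cbilinear (bmult D)" "clinear (bcomult D)" "\<And>h. bmult D h (bunit D) = h"
    using quantum_doubleD(1)[OF qd] by (auto simp: is_bialgebra_def is_algebra_def is_coalgebra_def)
  have A: "is_bialgebra A" "clinear (bcounit A)"
    using hopf by (auto simp: is_hopf_algebra_def is_bialgebra_def is_coalgebra_def)
  have lin\<tau>: "clinear \<tau>" and unit: "\<tau> (bunit D) = bunit D"
    using \<tau> by (auto simp: is_involution_def)
  note dm = cbilinear_clinear[OF cbilinear_dual_mult[OF D(2)]]
  \<comment> \<open>Isolates the first leg of the inverse R-matrix as a linear argument, into which
    the scalars \<open>bcounit A (e i)\<close> produced by the second leg can be moved.\<close>
  define g where "g \<zeta> = dual_mult D (left_act D (\<tau> (emb_minus A \<zeta>)) ?a) ?b" for \<zeta>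
  have "clinear (emb_minus A)"
    using hm by blast
  then have ling: "clinear g"
    unfolding g_def
    by (intro clinear_compose[OF clinear_compose[OF clinear_compose[OF _ lin\<tau>]
        cbilinear_clinear(2)[OF cbilinear_left_act[OF D(1)]]] dm(2)])
  have "re_mult A D \<tau> ?a ?b = (\<Sum>i\<in>I. g (bcounit A (e i) *\<^sub>C e' i))"
    unfolding re_mult_def universal_R_bar_eq[OF hopf qd db] clinear_sum[OF clinear_tensor_lift]
    by (simp add: tensor_lift_tens cbilinear_re_mult_inner[OF quantum_doubleD(1)[OF qd] lin\<tau>]
        right_act_dual_emb_minus[OF A(1) qd] clinear_scale[OF dm(1)] clinear_scale[OF ling])
      (simp add: g_def)
  \<comment> \<open>The argument is now the expansion of \<epsilon>, the unit of
    \<open>Hminus A\<close>, in the basis \<open>e'\<close>.\<close>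
  also have "\<dots> = g (\<Sum>i\<in>I. \<langle>Dual (bcounit A), e i\<rangle> *\<^sub>C e' i)"
    by (simp add: clinear_sum[OF ling] pairing_Dual A(2))
  also have "\<dots> = g (bunit (Hminus A))"
    by (simp only: dual_bases_expand_dual[OF db, of "Dual (bcounit A)", symmetric] Hminus_simps)
  also have "\<dots> = dual_mult D ?a ?b"
  proof -
    \<comment> \<open>\<open>emb_minus A\<close> and \<open>\<tau>\<close> preserve units, so the
      remaining action is by \<open>bunit D\<close>; under \<open>Dual\<close> this leaves the
      functional \<open>pairing ?a\<close> itself.\<close>
    have "left_act D (bunit D) ?a = ?a"
      by (simp add: left_act_def D(3) pairing_inverse)
    then show ?thesis
      using hm by (simp add: g_def unit)
  qed
  finally show ?thesis
    by (simp add: dual_mult_dual_emb[OF A(1) qd])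
qed

theorem theorem20:
  fixes Hp :: "'a::complex_vector bialg"
    and antipode :: "'a \<Rightarrow> 'a"
    and H :: "('a \<otimes> 'a dual) bialg"
    and \<tau> :: "'a \<otimes> 'a dual \<Rightarrow> 'a \<otimes> 'a dual"
    and I :: "'i set" and e :: "'i \<Rightarrow> 'a" and e' :: "'i \<Rightarrow> 'a dual"
  assumes "finite_dim TYPE('a)"
    and "is_hopf_algebra Hp antipode"
    and "bij antipode"
    and "is_quantum_double Hp H"
    and "is_involution H \<tau>"
    and "\<tau> ` range (emb_plus Hp) \<subseteq> range (emb_plus Hp)"
    and "\<tau> ` range (emb_minus Hp) \<subseteq> range (emb_minus Hp)"
    and "dual_bases I e e'"
  shows "universal_S =
    tensor_mult (bmult H) (re_mult Hp H \<tau>)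
      (\<Sum>\<mu>\<in>I. emb_plus Hp (e \<mu>) \<otimes> dual_emb_plus Hp (e' \<mu>))
      (\<Sum>\<nu>\<in>I. emb_minus Hp (e' \<nu>) \<otimes> dual_emb_minus Hp (e \<nu>))"
proof -
  have Hp: "is_bialgebra Hp"
    using assms(2) by (simp add: is_hopf_algebra_def)
  have mH: "cbilinear (bmult H)"
    using quantum_doubleD(1)[OF assms(4)] by (simp add: is_bialgebra_def is_algebra_def)
  have "clinear \<tau>"
    using assms(5) by (simp add: is_involution_def)
  then have mR: "cbilinear (re_mult Hp H \<tau>)"
    by (rule cbilinear_re_mult[OF quantum_doubleD(1)[OF assms(4)]])
  \<comment> \<open>The canonical element does not depend on the basis, so it is evaluated on the
    product basis of the double.\<close>
  have "universal_S = (\<Sum>\<mu>\<in>I. \<Sum>\<nu>\<in>I. (e \<mu> \<otimes> e' \<nu>) \<otimes> dual_tens (e' \<mu>) (e \<nu>))"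
    unfolding universal_S_def canonical_element_eq[OF dual_bases_tensor[OF assms(8)]]
    by (simp add: sum.cartesian_product split_def)
  \<comment> \<open>Expanding the right-hand side bilinearly, the first leg of each summand is a
    product already in the order of \<open>emb_plus_mult_emb_minus\<close>, and the second is the RE
    product computed in \<open>re_mult_dual_emb\<close>.\<close>
  then show ?thesis
    by (simp add: cbilinear_sum[OF cbilinear_tensor_mult[OF mH mR]] tensor_mult_tens[OF mH mR]
        emb_plus_mult_emb_minus[OF Hp assms(4)]
        re_mult_dual_emb[OF assms(2,4,5,8)])
qed

end
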